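(* Let $(\mathcal M,\cdot)$ be a group and let $f,g\colon\mathcal M\to\mathbb R\cup\{+\infty\}$. Then the conjugate of the infimal convolution $f\mathbin{\square}g$ equals the sum of the conjugates when restricted to the linear space $\mathcal H=\operatorname{Hom}((\mathcal M,\cdot),(\mathbb R,+))$ of group homomorphisms from $\mathcal M$ into the additive reals, i.e., $$(f\mathbin{\square} g)^\star(\varphi)=f^\star(\varphi)+g^\star(\varphi)\qquad\text{for all }\varphi\in\mathcal H.$$
   Context: The infimal convolution of $f,g\colon\mathcal M\to\mathbb R\cup\{+\infty\}$ on the group $\mathcal M$ is the function $f\mathbin{\square}g\colon\mathcal M\to\mathbb R\cup\{+\infty,-\infty\}$, $(f\mathbin{\square}g)(x):=\inf_{y\in\mathcal M}\{f(x\cdot y^{-1})+g(y)\}=\inf_{z\in\mathcal M}\{f(z)+g(z^{-1}\cdot x)\}$. For $h\colon\mathcal M\to\mathbb R\cup\{+\infty,-\infty\}$ and $\varphi\colon\mathcal M\to\mathbb R$, the nonlinear Fenchel conjugate is $h^\star(\varphi):=\sup_{x\in\mathcal M}\{\varphi(x)-h(x)\}\in\mathbb R\cup\{+\infty,-\infty\}$. Arithmetic in $\mathbb R\cup\{+\infty,-\infty\}$ is the natural one, with $(+\infty)+(-\infty)$ left undefined.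
   Formalization: The equality is asserted only for those φ for which the sum f*(φ)+g*(φ) is defined, i.e. is not (+∞)+(−∞); this excludes only cases where one of f, g is identically +∞ and the conjugate of the other is +∞ at φ. *)

theory Defs
  imports "HOL-Algebra.Group" "HOL-Library.Extended_Real"
begin

definition real_add_group :: "real monoid"
  where "real_add_group = \<lparr>carrier = UNIV, monoid.mult = (+), one = 0\<rparr>"

lemma group_real_add_group: "group real_add_group"
  unfolding real_add_group_def
  by (rule groupI) (auto intro: exI [of _ "- x" for x])

(* The group need not be commutative. All functions are relevant only on carrier G. *)
definition inf_conv ::
    "('a, 'b) monoid_scheme \<Rightarrow> ('a \<Rightarrow> ereal) \<Rightarrow> ('a \<Rightarrow> ereal) \<Rightarrow> 'a \<Rightarrow> ereal"
  where "inf_conv G f g x = (INF y\<in>carrier G. f (x \<otimes>\<^bsub>G\<^esub> inv\<^bsub>G\<^esub> y) + g y)"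

lemma (in group) inf_conv_alt:
  assumes "x \<in> carrier G"
  shows "inf_conv G f g x = (INF z\<in>carrier G. f z + g (inv z \<otimes> x))"
proof -
  have "(\<lambda>y. f (x \<otimes> inv y) + g y) ` carrier G = (\<lambda>z. f z + g (inv z \<otimes> x)) ` carrier G"
  proof (intro equalityI image_subsetI)
    fix y assume "y \<in> carrier G"
    then have "f (x \<otimes> inv y) + g y = f (x \<otimes> inv y) + g (inv (x \<otimes> inv y) \<otimes> x)"
      using assms by (simp add: inv_mult_group m_assoc)
    then show "f (x \<otimes> inv y) + g y \<in> (\<lambda>z. f z + g (inv z \<otimes> x)) ` carrier G"
      using assms \<open>y \<in> carrier G\<close> by blast
  next
    fix z assume "z \<in> carrier G"
    then have "f z + g (inv z \<otimes> x) = f (x \<otimes> inv (inv z \<otimes> x)) + g (inv z \<otimes> x)"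
      using assms by (simp add: inv_mult_group flip: m_assoc)
    then show "f z + g (inv z \<otimes> x) \<in> (\<lambda>y. f (x \<otimes> inv y) + g y) ` carrier G"
      using assms \<open>z \<in> carrier G\<close> by blast
  qed
  then show ?thesis by (simp add: inf_conv_def)
qed

definition conjugate ::
    "('a, 'b) monoid_scheme \<Rightarrow> ('a \<Rightarrow> ereal) \<Rightarrow> ('a \<Rightarrow> real) \<Rightarrow> ereal"
  where "conjugate G h \<phi> = (SUP x\<in>carrier G. ereal (\<phi> x) - h x)"

(* Type ereal makes addition total by setting \<infinity> + (- \<infinity>) = \<infinity>. Mathematically
   this sum is undefined; the predicate below marks the sums that do not use the convention. *)
definition ereal_sum_defined :: "ereal \<Rightarrow> ereal \<Rightarrow> bool"
  where "ereal_sum_defined a b \<longleftrightarrow>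
    \<not> (a = \<infinity> \<and> b = - \<infinity>) \<and> \<not> (a = - \<infinity> \<and> b = \<infinity>)"

lemma hom_real_zero: "(\<lambda>x. 0) \<in> hom G real_add_group"
  and hom_real_add: "\<lbrakk>\<phi> \<in> hom G real_add_group; \<psi> \<in> hom G real_add_group\<rbrakk>
    \<Longrightarrow> (\<lambda>x. \<phi> x + \<psi> x) \<in> hom G real_add_group"
  and hom_real_scale: "\<phi> \<in> hom G real_add_group \<Longrightarrow> (\<lambda>x. c * \<phi> x) \<in> hom G real_add_group"
  by (auto simp: hom_def real_add_group_def algebra_simps)

end

theory Submission
  imports Defs
begin

text \<open>Take \<open>b y\<close> out of the inner supremum, then \<open>?a\<close> out of the
  outer one. A constant may be taken out only if it is not \<open>- \<infinity>\<close>, which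
  forces the case distinctions below.\<close>

lemma SUP_SUP_add_ereal:
  fixes a :: "'a \<Rightarrow> ereal" and b :: "'b \<Rightarrow> ereal"
  assumes "A \<noteq> {}" "B \<noteq> {}"
    and a: "\<And>z. z \<in> A \<Longrightarrow> a z \<noteq> \<infinity>"
    and sum: "ereal_sum_defined (SUP z\<in>A. a z) (SUP y\<in>B. b y)"
  shows "(SUP y\<in>B. SUP z\<in>A. a z + b y) = (SUP z\<in>A. a z) + (SUP y\<in>B. b y)"
    (is "?S = ?a + ?b")
proof (rule antisym)
  show "?S \<le> ?a + ?b"
    by (intro SUP_least add_mono SUP_upper)
  \<comment> \<open>For \<open>b y = - \<infinity>\<close> this can fail: if
    \<open>?a = \<infinity>\<close> with every \<open>a z\<close> finite, each
    \<open>a z + b y\<close> is \<open>- \<infinity>\<close> but \<open>?a + b y\<close> is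
    \<open>\<infinity>\<close>.\<close>
  have part: "?a + b y \<le> ?S" if "y \<in> B" "b y \<noteq> - \<infinity>" for y
  proof -
    have "?a + b y = (SUP z\<in>A. a z + b y)"
      using that assms by (intro SUP_ereal_add_left [symmetric]) auto
    also have "\<dots> \<le> ?S"
      using that by (intro SUP_upper)
    finally show ?thesis .
  qed
  show "?a + ?b \<le> ?S"
  proof (cases "?a = - \<infinity> \<or> ?b = - \<infinity>")
    case True
    \<comment> \<open>By \<open>sum\<close>, the other summand is not \<open>\<infinity>\<close>, so
      the sum is a genuine \<open>- \<infinity>\<close>.\<close>
    then have "?a + ?b = - \<infinity>"
      using sum by (auto simp: ereal_sum_defined_def ereal_plus_eq_MInfty)
    also have "\<dots> \<le> ?S" by simp
    finally show ?thesis .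
  next
    case False
    show ?thesis
    proof (cases "?a = \<infinity>")
      case True
      \<comment> \<open>Here \<^term>\<open>?a + b y\<close> is the junk value \<^term>\<open>\<infinity>\<close> where
        \<^term>\<open>b y = - \<infinity>\<close>, so such \<^term>\<open>y\<close> must be avoided.\<close>
      have "\<exists>y\<in>B. b y \<noteq> - \<infinity>"
      proof (rule ccontr)
        assume "\<not> ?thesis"
        then have "?b \<le> - \<infinity>" by (intro SUP_least) auto
        then show False using False by simp
      qed
      then obtain y where "y \<in> B" "b y \<noteq> - \<infinity>" by blast
      then show ?thesis using part [of y] True by simp
    next
      case fin: False
      have "?a + b y \<le> ?S" if "y \<in> B" for y
      proof (cases "b y = - \<infinity>")
        case True
        then have "?a + b y = - \<infinity>" using fin by (simp add: ereal_plus_eq_MInfty)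
        also have "\<dots> \<le> ?S" by simp
        finally show ?thesis .
      qed (rule part [OF that])
      then have "(SUP y\<in>B. ?a + b y) \<le> ?S"
        by (intro SUP_least)
      moreover have "(SUP y\<in>B. ?a + b y) = ?a + ?b"
        using False \<open>B \<noteq> {}\<close> by (intro SUP_ereal_add_right) auto
      ultimately show ?thesis by simp
    qed
  qed
qed

text \<open>Substituting \<open>x = z \<otimes> y\<close> makes the two arguments independent, and
  additivity of \<open>\<phi>\<close> separates the terms.\<close>

lemma (in group) conjugate_inf_conv:
  assumes hom: "\<phi> \<in> hom G real_add_group"
    and f: "\<And>x. x \<in> carrier G \<Longrightarrow> f x \<noteq> - \<infinity>"
    and g: "\<And>x. x \<in> carrier G \<Longrightarrow> g x \<noteq> - \<infinity>"
  shows "conjugate G (inf_conv G f g) \<phi> =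
    (SUP y\<in>carrier G. SUP z\<in>carrier G. (ereal (\<phi> z) - f z) + (ereal (\<phi> y) - g y))"
proof -
  let ?t = "\<lambda>z y. (ereal (\<phi> z) - f z) + (ereal (\<phi> y) - g y)"
  \<comment> \<open>Since \<open>f z\<close> and \<open>g y\<close> avoid
    \<open>- \<infinity>\<close>, no sum here mixes opposite infinities.\<close>
  have split: "ereal (\<phi> (z \<otimes> y)) - (f z + g y) = ?t z y"
    if "z \<in> carrier G" "y \<in> carrier G" for z y
  proof -
    have "\<phi> (z \<otimes> y) = \<phi> z + \<phi> y"
      using hom that by (simp add: hom_def real_add_group_def)
    then show ?thesis
      using f [of z] g [of y] that by (cases "f z"; cases "g y") auto
  qed
  have "ereal (\<phi> x) - inf_conv G f g x = (SUP y\<in>carrier G. ?t (x \<otimes> inv y) y)"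
    if x: "x \<in> carrier G" for x
  proof -
    \<comment> \<open>Subtraction from the finite number \<open>\<phi> x\<close> turns the infimum
      into a supremum.\<close>
    have "ereal (\<phi> x) - inf_conv G f g x =
        (SUP y\<in>carrier G. ereal (\<phi> x) - (f (x \<otimes> inv y) + g y))"
      unfolding inf_conv_def using x by (intro SUP_ereal_minus_right [symmetric]) auto
    also have "\<dots> = (SUP y\<in>carrier G. ?t (x \<otimes> inv y) y)"
    proof (rule SUP_cong [OF refl])
      fix y assume "y \<in> carrier G"
      then show "ereal (\<phi> x) - (f (x \<otimes> inv y) + g y) = ?t (x \<otimes> inv y) y"
        using split [of "x \<otimes> inv y" y] x by (simp add: m_assoc)
    qed
    finally show ?thesis .
  qed
  then have "conjugate G (inf_conv G f g) \<phi> =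
      (SUP x\<in>carrier G. SUP y\<in>carrier G. ?t (x \<otimes> inv y) y)"
    unfolding conjugate_def by (rule SUP_cong [OF refl])
  \<comment> \<open>With \<open>y\<close> now fixed in the inner supremum, right translation by
    \<open>inv y\<close> maps the carrier onto itself, so \<open>z = x \<otimes> inv y\<close> can
    replace \<open>x\<close>.\<close>
  also have "\<dots> = (SUP y\<in>carrier G. SUP x\<in>carrier G. ?t (x \<otimes> inv y) y)"
    by (rule SUP_commute)
  also have "\<dots> = (SUP y\<in>carrier G. SUP z\<in>carrier G. ?t z y)"
  proof (rule SUP_cong [OF refl])
    fix y assume y: "y \<in> carrier G"
    have "(\<lambda>x. x \<otimes> inv y) ` carrier G = carrier G"
    proof
      show "carrier G \<subseteq> (\<lambda>x. x \<otimes> inv y) ` carrier G"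
      proof
        fix z assume "z \<in> carrier G"
        then show "z \<in> (\<lambda>x. x \<otimes> inv y) ` carrier G"
          using y by (intro image_eqI [of _ _ "z \<otimes> y"]) (simp_all add: m_assoc)
      qed
    qed (use y in auto)
    then have "(\<lambda>z. ?t z y) ` carrier G = (\<lambda>x. ?t (x \<otimes> inv y) y) ` carrier G"
      by (metis (no_types, lifting) image_cong image_image)
    then show "(SUP x\<in>carrier G. ?t (x \<otimes> inv y) y) = (SUP z\<in>carrier G. ?t z y)"
      by simp
  qed
  finally show ?thesis .
qed

text \<open>The premise on the sum excludes cases such as \<open>f\<close> constantly
  \<open>\<infinity>\<close> with \<open>conjugate G g \<phi> = \<infinity>\<close>: there the left
  side is \<open>- \<infinity>\<close>, while the convention makes the right side
  \<open>\<infinity>\<close>.\<close>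

theorem proposition6p1:
  fixes G :: "('a, 'b) monoid_scheme"
    and f g :: "'a \<Rightarrow> ereal"
  assumes "group G"
    and "\<And>x. x \<in> carrier G \<Longrightarrow> f x \<noteq> - \<infinity>"
    and "\<And>x. x \<in> carrier G \<Longrightarrow> g x \<noteq> - \<infinity>"
  shows "\<forall>\<phi> \<in> hom G real_add_group.
    ereal_sum_defined (conjugate G f \<phi>) (conjugate G g \<phi>) \<longrightarrow>
    conjugate G (inf_conv G f g) \<phi> = conjugate G f \<phi> + conjugate G g \<phi>"
proof (intro ballI impI)
  interpret group G by fact
  fix \<phi> assume hom: "\<phi> \<in> hom G real_add_group"
    and sum: "ereal_sum_defined (conjugate G f \<phi>) (conjugate G g \<phi>)"
  have "ereal (\<phi> z) - f z \<noteq> \<infinity>" if "z \<in> carrier G" for z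
    using assms(2) [OF that] by (cases "f z") auto
  then have "(SUP y\<in>carrier G. SUP z\<in>carrier G. (ereal (\<phi> z) - f z) + (ereal (\<phi> y) - g y)) =
      conjugate G f \<phi> + conjugate G g \<phi>"
    using sum unfolding conjugate_def by (intro SUP_SUP_add_ereal) auto
  then show "conjugate G (inf_conv G f g) \<phi> = conjugate G f \<phi> + conjugate G g \<phi>"
    using conjugate_inf_conv [OF hom assms(2,3)] by simp
qed

end
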